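(* Let $ABCD$ be a quadrangle with a reflex interior angle at $C$ and whose other interior angles (at $A$, $B$, $D$) are acute. Consider the line segment $AC$ and draw the line through $C$ perpendicular to $AC$. The triangle of minimal perimeter with one vertex on $AB$, one vertex on $AD$, and the third vertex on either $BC$ or $CD$ is determined by the following exhaustive cases: (A) If the perpendicular intersects the sides $AB$ and $AD$ at points $M$ and $N$ respectively, then the orthic triangle of $\triangle AMN$ is the triangle of minimal perimeter. (B) Otherwise, without loss of generality (that is, up to interchanging the roles of $B$ and $D$), assume that the perpendicular does not meet $AB$. Extend the side $BC$ to meet $AD$ at the point $W$. Then the orthic triangle of $\triangle ABW$ is the triangle of minimal perimeter.
   Context: All objects lie in the Euclidean plane. For points $A,B$, the symbol $AB$ denotes the closed line segment with endpoints $A$ and $B$; the sides of the quadrangle $ABCD$ are the closed segments $AB$, $BC$, $CD$, $AD$. A reflex angle is an interior angle greater than $180^\circ$ (so $ABCD$ is nonconvex at $C$). The perimeter of a triangle $XYZ$ is $|XY|+|YZ|+|XZ|$. The competing triangles are the triangles $XYZ$ with $X$ on $AB$, $Y$ on $AD$, and $Z$ on $BC$ or on $CD$; "the triangle of minimal perimeter" means the one whose perimeter is smallest among all of these. In (B), "extending $BC$ to meet $AD$" means prolonging the segment $BC$ beyond $C$ until it meets the side $AD$, at $W$. The orthic triangle of an acute-angled triangle is the triangle whose vertices are the feet of the perpendiculars drawn from its three vertices to the respective opposite sides. *)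

theory Defs
  imports "HOL-Analysis.Analysis"
begin

type_synonym point = "real ^ 2"

definition quadrangle_boundary :: "point \<Rightarrow> point \<Rightarrow> point \<Rightarrow> point \<Rightarrow> real \<Rightarrow> point" where
  "quadrangle_boundary A B C D =
     linepath A B +++ linepath B C +++ linepath C D +++ linepath D A"

definition quadrangle :: "point \<Rightarrow> point \<Rightarrow> point \<Rightarrow> point \<Rightarrow> bool" where
  "quadrangle A B C D \<longleftrightarrow> simple_path (quadrangle_boundary A B C D)"

definition quadrangle_interior :: "point \<Rightarrow> point \<Rightarrow> point \<Rightarrow> point \<Rightarrow> point set" where
  "quadrangle_interior A B C D = inside (path_image (quadrangle_boundary A B C D))"

definition vertex_angle :: "point \<Rightarrow> point \<Rightarrow> point \<Rightarrow> real" where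
  "vertex_angle U V W = arccos (((U - V) \<bullet> (W - V)) / (norm (U - V) * norm (W - V)))"

definition wedge :: "point \<Rightarrow> point \<Rightarrow> point \<Rightarrow> point set" where
  "wedge U V W = {V + s *\<^sub>R (U - V) + t *\<^sub>R (W - V) | s t. s \<ge> 0 \<and> t \<ge> 0}"

text \<open>
  The two sides of a polygon at a vertex \<open>V\<close> with neighbours \<open>U\<close> and \<open>W\<close> cut a small disc around
  \<open>V\<close> into two sectors: the part in the wedge, with angle \<open>vertex_angle U V W\<close>, and the rest, with
  angle \<open>2 pi - vertex_angle U V W\<close>.  The interior angle of a polygon with interior \<open>S\<close> is the
  angle of the sector that lies in \<open>S\<close>.  (For a straight angle the rest consists of two open half
  discs on different sides of the polygon, and both expressions equal \<open>pi\<close>.)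
\<close>

definition interior_angle :: "point set \<Rightarrow> point \<Rightarrow> point \<Rightarrow> point \<Rightarrow> real" where
  "interior_angle S U V W =
     (if \<exists>e>0. ball V e - wedge U V W \<subseteq> S then 2 * pi - vertex_angle U V W
      else vertex_angle U V W)"

definition acute_triangle :: "point \<Rightarrow> point \<Rightarrow> point \<Rightarrow> bool" where
  "acute_triangle P Q R \<longleftrightarrow> \<not> collinear {P, Q, R} \<and>
     vertex_angle R P Q < pi / 2 \<and> vertex_angle P Q R < pi / 2 \<and> vertex_angle Q R P < pi / 2"

definition foot :: "point \<Rightarrow> point \<Rightarrow> point \<Rightarrow> point" where
  "foot P Q R = (THE F. F \<in> affine hull {Q, R} \<and> orthogonal (P - F) (R - Q))"

lemma foot_ex1:
  assumes "Q \<noteq> R"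
  shows "\<exists>!F. F \<in> affine hull {Q, R} \<and> orthogonal (P - F) (R - Q)"
proof -
  define d where "d = R - Q"
  have d0: "d \<bullet> d \<noteq> 0" using assms by (simp add: d_def)
  have aff: "F \<in> affine hull {Q, R} \<longleftrightarrow> (\<exists>t. F = Q + t *\<^sub>R d)" for F
  proof
    assume "F \<in> affine hull {Q, R}"
    then obtain u v where "u + v = 1" "F = u *\<^sub>R Q + v *\<^sub>R R"
      by (auto simp: affine_hull_2)
    then have "F = Q + v *\<^sub>R d"
      by (metis (no_types, lifting) add.commute add_diff_cancel_right' d_def diff_add_eq
          scaleR_left_diff_distrib scaleR_one scaleR_right_diff_distrib diff_diff_eq2)
    then show "\<exists>t. F = Q + t *\<^sub>R d" ..
  next
    assume "\<exists>t. F = Q + t *\<^sub>R d"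
    then obtain t where "F = (1 - t) *\<^sub>R Q + t *\<^sub>R R"
      by (auto simp: d_def algebra_simps)
    then show "F \<in> affine hull {Q, R}"
      unfolding affine_hull_2 by (intro CollectI exI[of _ "1 - t"] exI[of _ t]) simp
  qed
  have orth: "orthogonal (P - (Q + t *\<^sub>R d)) d \<longleftrightarrow> t = ((P - Q) \<bullet> d) / (d \<bullet> d)" for t
    using d0 by (auto simp: orthogonal_def inner_diff_left inner_add_left field_simps)
  show ?thesis
    using aff orth unfolding d_def[symmetric] by (metis (no_types, lifting))
qed

text \<open>
  A triangle \<open>XYZ\<close> is represented by the triple \<open>(X, Y, Z)\<close>.  The vertices of the orthic triangle
  of \<open>PQR\<close> are listed by the sides they lie on, in the order \<open>PQ\<close>, \<open>PR\<close>, \<open>QR\<close>.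
\<close>

definition orthic_triangle :: "point \<Rightarrow> point \<Rightarrow> point \<Rightarrow> point \<times> point \<times> point" where
  "orthic_triangle P Q R = (foot R P Q, foot Q P R, foot P Q R)"

fun perimeter :: "point \<times> point \<times> point \<Rightarrow> real" where
  "perimeter (X, Y, Z) = dist X Y + dist Y Z + dist X Z"

fun nondegenerate :: "point \<times> point \<times> point \<Rightarrow> bool" where
  "nondegenerate (X, Y, Z) \<longleftrightarrow> \<not> collinear {X, Y, Z}"

definition competing_triangles ::
    "point \<Rightarrow> point \<Rightarrow> point \<Rightarrow> point \<Rightarrow> (point \<times> point \<times> point) set" where
  "competing_triangles A B C D =
     closed_segment A B \<times> closed_segment A D \<times> (closed_segment B C \<union> closed_segment C D)"

text \<open>
  The minimal triangle has to be a genuine one, but it is compared with the degenerate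
  triples as well; this is at least as strong as comparing it with genuine triangles only.
\<close>

definition minimal_perimeter_triangle ::
    "point \<Rightarrow> point \<Rightarrow> point \<Rightarrow> point \<Rightarrow> point \<times> point \<times> point \<Rightarrow> bool" where
  "minimal_perimeter_triangle A B C D T \<longleftrightarrow>
     T \<in> competing_triangles A B C D \<and> nondegenerate T \<and>
     (\<forall>T' \<in> competing_triangles A B C D. T' \<noteq> T \<longrightarrow> perimeter T < perimeter T')"

definition perpendicular_at :: "point \<Rightarrow> point \<Rightarrow> point set" where
  "perpendicular_at A C = {P. orthogonal (P - C) (A - C)}"

definition prolongation :: "point \<Rightarrow> point \<Rightarrow> point set" where
  "prolongation B C = {W. C \<in> open_segment B W}"

end

theory Submission
  imports Defs
begin

text \<open>
  In both cases a triangle \<open>AQR\<close> is cut off at the corner \<open>A\<close>, with \<open>Q\<close> on \<open>AB\<close> and \<open>R\<close> on \<open>AD\<close>: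
  it is \<open>AMN\<close> in case (A) and \<open>ABW\<close> in case (B).  Let \<open>F\<close> be the foot of its altitude from \<open>A\<close>.
  By Fagnano's theorem the orthic triangle has the least perimeter among the triangles inscribed
  in \<open>AQR\<close>.  What is needed here is a stronger form, \<open>fagnano_beyond_side\<close>: the third vertex \<open>Z\<close> may
  lie anywhere on the line \<open>QR\<close> or on the side of it away from \<open>A\<close>, and the first two vertices
  anywhere on the lines \<open>AQ\<close> and \<open>AR\<close>.  The proof is a calibration: the perimeter is at least the
  sum of the projections of the sides to the side directions of the orthic triangle, and the
  reflection law at the vertices of the orthic triangle makes this sum equal to a constant plus a
  nonnegative multiple of the distance from \<open>Z\<close> to the line \<open>QR\<close>.  The discussion of equality shows
  that the minimum is strict.

  It remains to see that the broken line \<open>BCD\<close> contains \<open>F\<close> and stays on the line \<open>QR\<close> or beyond it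
  (\<open>orthic_triangle_minimal\<close>).  The reflex angle forces \<open>C\<close> to be interior to the triangle \<open>ABD\<close>
  (\<open>reflex_vertex_in_triangle\<close>).  In case (A) the line \<open>MN\<close> is the perpendicular, \<open>F\<close> is \<open>C\<close>, and \<open>B\<close> and
  \<open>D\<close> are on it or beyond it, since \<open>AB\<close> and \<open>AD\<close> meet it.  In case (B) the vertex \<open>B\<close> is on the
  same side of the perpendicular as \<open>A\<close>, so that the triangle \<open>ABC\<close> is acute at \<open>B\<close> and \<open>C\<close> and the
  altitude from \<open>A\<close> ends on the side \<open>BC\<close> (\<open>altitude_to_prolonged_side\<close>); the side \<open>BC\<close> is part of
  the line \<open>BW\<close>, and \<open>CD\<close> is beyond it because \<open>AD\<close> meets it at \<open>W\<close>.
\<close>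

section \<open>Acute angles as signs of inner products\<close>

lemma abs_normalized_inner_le_1: "\<bar>(x \<bullet> y) / (norm x * norm y)\<bar> \<le> 1"
  for x y :: "'a::real_inner"
  using Cauchy_Schwarz_ineq2[of x y]
  by (cases "x = 0 \<or> y = 0") (auto simp: abs_mult)

lemma vertex_angle_le_pi: "vertex_angle U V W \<le> pi"
  unfolding vertex_angle_def
  using abs_normalized_inner_le_1[of "U - V" "W - V"] by (intro arccos_ubound) linarith+

lemma vertex_angle_acute_iff: "vertex_angle U V W < pi / 2 \<longleftrightarrow> (U - V) \<bullet> (W - V) > 0"
proof -
  define c where "c = ((U - V) \<bullet> (W - V)) / (norm (U - V) * norm (W - V))"
  have "\<bar>c\<bar> \<le> 1"
    unfolding c_def by (rule abs_normalized_inner_le_1)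
  then have "vertex_angle U V W < pi / 2 \<longleftrightarrow> c > 0"
    using arccos_less_mono[of c 0] by (simp add: vertex_angle_def c_def)
  also have "\<dots> \<longleftrightarrow> (U - V) \<bullet> (W - V) > 0"
    unfolding c_def zero_less_divide_iff by (auto simp: zero_less_mult_iff not_less mult_less_0_iff)
  finally show ?thesis .
qed

text \<open>
  The sector outside the wedge has angle at least \<open>pi\<close>, because \<open>vertex_angle\<close> is at most \<open>pi\<close>.
  So an interior angle below \<open>pi / 2\<close> has to be the one in the wedge, and one above \<open>pi\<close> has to be
  the other one.
\<close>

lemma interior_angle_acute_imp_inner_pos:
  assumes "interior_angle S U V W < pi / 2"
  shows "(U - V) \<bullet> (W - V) > 0"
  using assms vertex_angle_le_pi[of U V W] pi_gt_zero
  by (auto simp: interior_angle_def vertex_angle_acute_iff[symmetric] split: if_splits)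

lemma reflex_imp_interior_outside_wedge:
  assumes "interior_angle S U V W > pi"
  obtains e where "e > 0" "ball V e - wedge U V W \<subseteq> S"
  using assms vertex_angle_le_pi[of U V W] by (auto simp: interior_angle_def split: if_splits)

text \<open>
  Noncollinearity comes for free: of three collinear points one lies between the other two, and
  the inner product taken at that one is not positive.
\<close>

lemma acute_triangleI:
  assumes P: "(Q - P) \<bullet> (R - P) > 0" and Q: "(P - Q) \<bullet> (R - Q) > 0" and R: "(Q - R) \<bullet> (P - R) > 0"
  shows "acute_triangle P Q R"
proof -
  have obtuse: "(x - p) \<bullet> (y - p) \<le> 0" if between: "between (x, y) p" for p x y :: point
  proof -
    obtain t where t: "0 \<le> t" "t \<le> 1" "p = (1 - t) *\<^sub>R x + t *\<^sub>R y"
      using between by (auto simp: between_mem_segment in_segment)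
    have "x - p = t *\<^sub>R (x - y)" "y - p = - ((1 - t) *\<^sub>R (x - y))"
      by (simp_all add: t algebra_simps)
    then have "(x - p) \<bullet> (y - p) = - (t * (1 - t) * ((x - y) \<bullet> (x - y)))"
      by (simp del: scaleR_right_diff_distrib)
    then show ?thesis
      using t by simp
  qed
  have "\<not> collinear {P, Q, R}"
    using obtuse[of Q R P] obtuse[of R P Q] obtuse[of P Q R] P Q R
    by (auto simp: collinear_between_cases inner_commute)
  then show ?thesis
    using P Q R unfolding acute_triangle_def vertex_angle_acute_iff by (simp add: inner_commute)
qed

section \<open>The reflex vertex lies inside the triangle of the other three\<close>

lemma not_in_interior_imp_supporting_halfspace:
  fixes S :: "'a::euclidean_space set"
  assumes "convex S" "x \<notin> interior S"
  obtains a where "a \<noteq> 0" "\<And>y. y \<in> S \<Longrightarrow> a \<bullet> (y - x) \<ge> 0"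
proof (cases "interior S = {}")
  case True
  then obtain a b where a: "a \<noteq> 0" "S \<subseteq> {y. a \<bullet> y = b}"
    using empty_interior_subset_hyperplane[OF \<open>convex S\<close>] by blast
  show ?thesis
  proof (cases "a \<bullet> x \<le> b")
    case True
    then show ?thesis
      using a that[of a] by (auto simp: inner_diff_right)
  next
    case False
    then show ?thesis
      using a by (intro that[of "- a"]) (auto simp: inner_diff_right)
  qed
next
  case False
  then obtain a b where a: "a \<noteq> 0" "a \<bullet> x \<le> b" "\<forall>y\<in>interior S. a \<bullet> y \<ge> b"
    using separating_hyperplane_sets[of "{x}" "interior S"] assms by auto
  have "closure (interior S) \<subseteq> {y. a \<bullet> y \<ge> b}"
    using a by (intro closure_minimal closed_halfspace_ge) auto
  then have "S \<subseteq> {y. a \<bullet> y \<ge> b}"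
    using convex_closure_interior[OF \<open>convex S\<close> False] closure_subset by blast
  then show ?thesis
    using a that[of a] by (force simp: inner_diff_right)
qed

text \<open>
  Otherwise some closed half plane with \<open>C\<close> on its border contains \<open>A\<close>, \<open>B\<close> and \<open>D\<close>, hence all
  sides, hence the interior of the quadrangle, and also the wedge at \<open>C\<close>.  But at a reflex vertex
  a small disc around \<open>C\<close> is covered by the wedge and the interior, and no disc around a border
  point fits into a half plane.
\<close>

lemma reflex_vertex_in_triangle:
  assumes "interior_angle (quadrangle_interior A B C D) B C D > pi"
  shows "C \<in> interior (convex hull {A, B, D})"
proof (rule ccontr)
  assume "C \<notin> interior (convex hull {A, B, D})"
  then obtain a where "a \<noteq> 0" and half: "\<And>y. y \<in> convex hull {A, B, D} \<Longrightarrow> a \<bullet> (y - C) \<ge> 0"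
    using not_in_interior_imp_supporting_halfspace[of "convex hull {A, B, D}" C] by auto
  define H where "H = {y. a \<bullet> (y - C) \<ge> 0}"
  have vertices: "A \<in> H" "B \<in> H" "C \<in> H" "D \<in> H"
    using half by (auto simp: H_def hull_inc)
  have "H = {y. a \<bullet> y \<ge> a \<bullet> C}"
    by (auto simp: H_def inner_diff_right)
  then have "convex H"
    by (simp add: convex_halfspace_ge)
  have "path_image (quadrangle_boundary A B C D) \<subseteq> H"
    unfolding quadrangle_boundary_def
    using vertices \<open>convex H\<close>
    by (intro subset_trans[OF path_image_join_subset] Un_least)
       (auto simp: closed_segment_subset subset_iff dest: convex_contains_segment[THEN iffD1])
  then have inside: "quadrangle_interior A B C D \<subseteq> H"
    using outside_subset_convex[OF \<open>convex H\<close>] inside_Int_outside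
    unfolding quadrangle_interior_def by blast
  have wedge: "wedge B C D \<subseteq> H"
    using vertices by (auto simp: wedge_def H_def inner_add_right)
  obtain e where "e > 0" "ball C e - wedge B C D \<subseteq> quadrangle_interior A B C D"
    using assms by (rule reflex_imp_interior_outside_wedge)
  with inside wedge have ball: "ball C e \<subseteq> H"
    by blast
  \<comment> \<open>a point of the disc, displaced from \<open>C\<close> along the outer normal of the half plane\<close>
  define y where "y = C - (e / (2 * norm a)) *\<^sub>R a"
  have "y \<in> ball C e"
    using \<open>e > 0\<close> \<open>a \<noteq> 0\<close> by (simp add: y_def dist_norm)
  moreover have "y \<notin> H"
    using \<open>e > 0\<close> \<open>a \<noteq> 0\<close> by (simp add: y_def H_def not_le)
  ultimately show False
    using ball by blast
qed

text \<open>
  The position vector of \<open>C\<close> from \<open>A\<close> in the basis of the two sides at \<open>A\<close>; incidences are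
  later decided by comparing coefficients in this basis.
\<close>

lemma triangle_interior_coordinates:
  fixes A B C D :: point
  assumes "C \<in> interior (convex hull {A, B, D})"
  obtains y z where "y > 0" "z > 0" "y + z < 1" "C = A + y *\<^sub>R (B - A) + z *\<^sub>R (D - A)"
    "\<not> collinear {0, B - A, D - A}"
proof -
  have ncol: "\<not> collinear {A, B, D}"
  proof
    assume "collinear {A, B, D}"
    then have "A = B \<or> A = D \<or> B = D \<or> affine_dependent {A, B, D}"
      by (simp add: collinear_3_eq_affine_dependent)
    then have "interior (convex hull {A, B, D}) = {}"
      using interior_convex_hull_eq_empty[of "{A, B, D}"] empty_interior_convex_hull[of "{A, B, D}"]
      by (cases "A = B \<or> A = D \<or> B = D") (auto simp: card_insert_if)
    then show False
      using assms by simp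
  qed
  then obtain x y z where xyz: "0 < x" "0 < y" "0 < z" "x + y + z = 1"
      "x *\<^sub>R A + y *\<^sub>R B + z *\<^sub>R D = C"
    using assms interior_convex_hull_3_minimal[of A B D] by auto
  have x: "x = 1 - y - z" using xyz by simp
  have C: "C = A + y *\<^sub>R (B - A) + z *\<^sub>R (D - A)"
    unfolding xyz(5)[symmetric] x by (simp add: algebra_simps)
  have "\<not> collinear {0, B - A, D - A}"
    using ncol collinear_3[of B A D] by (auto simp: insert_commute)
  with C xyz show ?thesis
    using that[of y z] by simp
qed

section \<open>Fagnano's problem with the third vertex on or beyond a side\<close>

text \<open>
  A calibration of the perimeter.  Each side is at least as long as its projection to a unit
  vector, and the two orthogonality conditions say that the sum of the three projections does not
  change when \<open>X\<close> and \<open>Y\<close> slide along their lines through \<open>P\<close>.  Both may therefore be moved to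
  \<open>P\<close>, which leaves \<open>(P - Z) \<bullet> (e1 + e2)\<close>.  In the case of equality each side points in the
  direction of its unit vector.
\<close>

lemma calibrated_perimeter:
  fixes X Y Z P F e1 e2 e3 :: point
  assumes unit: "norm e1 = 1" "norm e2 = 1" "norm e3 = 1"
    and X: "(X - P) \<bullet> (e1 - e3) = 0"
    and Y: "(Y - P) \<bullet> (e2 + e3) = 0"
    and Z: "(Z - F) \<bullet> (e1 + e2) \<le> 0"
  shows "(P - F) \<bullet> (e1 + e2) \<le> perimeter (X, Y, Z)"
    and "perimeter (X, Y, Z) = (P - F) \<bullet> (e1 + e2) \<Longrightarrow>
      X - Z = dist X Z *\<^sub>R e1 \<and> Y - Z = dist Y Z *\<^sub>R e2 \<and> Y - X = dist X Y *\<^sub>R e3 \<and>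
      (Z - F) \<bullet> (e1 + e2) = 0"
proof -
  have total: "(X - Z) \<bullet> e1 + (Y - X) \<bullet> e3 + (Y - Z) \<bullet> e2
      = (P - F) \<bullet> (e1 + e2) - (Z - F) \<bullet> (e1 + e2)"
    using X Y by (simp add: inner_diff_left inner_diff_right inner_add_right)
  have 1: "(X - Z) \<bullet> e1 \<le> dist X Z" and 2: "(Y - Z) \<bullet> e2 \<le> dist Y Z"
    and 3: "(Y - X) \<bullet> e3 \<le> dist X Y"
    using norm_cauchy_schwarz[of "X - Z" e1] norm_cauchy_schwarz[of "Y - Z" e2]
      norm_cauchy_schwarz[of "Y - X" e3] unit by (simp_all add: dist_norm norm_minus_commute)
  show "(P - F) \<bullet> (e1 + e2) \<le> perimeter (X, Y, Z)"
    using total 1 2 3 Z by simp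
  assume "perimeter (X, Y, Z) = (P - F) \<bullet> (e1 + e2)"
  then have eq: "(X - Z) \<bullet> e1 = dist X Z" "(Y - Z) \<bullet> e2 = dist Y Z" "(Y - X) \<bullet> e3 = dist X Y"
    and Z0: "(Z - F) \<bullet> (e1 + e2) = 0"
    using total 1 2 3 Z by simp_all
  have aligned: "w = norm w *\<^sub>R e" if "norm e = 1" "w \<bullet> e = norm w" for w e :: point
    using that norm_cauchy_schwarz_eq[of w e] by simp
  show "X - Z = dist X Z *\<^sub>R e1 \<and> Y - Z = dist Y Z *\<^sub>R e2 \<and> Y - X = dist X Y *\<^sub>R e3 \<and>
      (Z - F) \<bullet> (e1 + e2) = 0"
    using aligned[of e1 "X - Z"] aligned[of e2 "Y - Z"] aligned[of e3 "Y - X"] eq unit Z0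
    by (simp add: dist_norm norm_minus_commute)
qed

lemma foot_eqI:
  assumes "F \<in> affine hull {Q, R}" "orthogonal (P - F) (R - Q)" "Q \<noteq> R"
  shows "foot P Q R = F"
  unfolding foot_def using assms foot_ex1[of Q R P] by (intro the1_equality) auto

lemma affine_hull_2_param: "X \<in> affine hull {P, Q} \<longleftrightarrow> (\<exists>t. X = P + t *\<^sub>R (Q - P))"
  for X P Q :: "'a::real_vector"
proof -
  have "P + t *\<^sub>R (Q - P) = (1 - t) *\<^sub>R P + t *\<^sub>R Q" for t
    by (simp add: algebra_simps)
  moreover have "u + v = 1 \<longleftrightarrow> u = 1 - v" for u v :: real
    by auto
  ultimately show ?thesis
    by (auto simp: affine_hull_2)
qed

lemma closed_segment_param:
  "X \<in> closed_segment P Q \<longleftrightarrow> (\<exists>t. 0 \<le> t \<and> t \<le> 1 \<and> X = P + t *\<^sub>R (Q - P))"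
  for X P Q :: "'a::real_vector"
proof -
  have "P + t *\<^sub>R (Q - P) = (1 - t) *\<^sub>R P + t *\<^sub>R Q" for t
    by (simp add: algebra_simps)
  then show ?thesis
    by (auto simp: in_segment)
qed

text \<open>
  Coordinates adapted to the altitude from \<open>P\<close>: the origin is its foot \<open>F\<close>, the axes are the side
  \<open>QR\<close> and the altitude.  The angle at \<open>P\<close> is acute exactly if \<open>m * n < h\<^sup>2\<close>.
\<close>

lemma altitude_frame:
  fixes P Q R F :: point
  assumes F: "F \<in> open_segment Q R" and perp: "orthogonal (P - F) (R - Q)"
    and acute: "(Q - P) \<bullet> (R - P) > 0"
  obtains u v h m n where "u \<bullet> u = 1" "v \<bullet> v = 1" "u \<bullet> v = 0" "h > 0" "m > 0" "n > 0"
    "m * n < h\<^sup>2" "P = F + h *\<^sub>R v" "Q = F - m *\<^sub>R u" "R = F + n *\<^sub>R u"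
proof -
  obtain t where t: "0 < t" "t < 1" "F = (1 - t) *\<^sub>R Q + t *\<^sub>R R" and "Q \<noteq> R"
    using F by (auto simp: in_segment)
  define L h where "L = norm (R - Q)" and "h = norm (P - F)"
  define u v where "u = (1 / L) *\<^sub>R (R - Q)" and "v = (1 / h) *\<^sub>R (P - F)"
  have "L > 0" using \<open>Q \<noteq> R\<close> by (simp add: L_def)
  then have RQ: "R - Q = L *\<^sub>R u" by (simp add: u_def)
  have Q: "Q = F - (t * L) *\<^sub>R u" 
    using t(3) unfolding scaleR_scaleR[symmetric] RQ[symmetric] by (simp add: algebra_simps)
  have R: "R = F + ((1 - t) * L) *\<^sub>R u" 
    using t(3) unfolding scaleR_scaleR[symmetric] RQ[symmetric] by (simp add: algebra_simps)
  have uu: "u \<bullet> u = 1"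
    using \<open>L > 0\<close> unfolding norm_eq_1[symmetric] by (simp add: u_def L_def)
  have up: "u \<bullet> (P - F) = 0"
    using perp by (simp add: orthogonal_def inner_commute u_def)
  have "(Q - P) \<bullet> (R - P) = (- (t * L) *\<^sub>R u - (P - F)) \<bullet> (((1 - t) * L) *\<^sub>R u - (P - F))"
    unfolding Q R by (simp add: algebra_simps)
  also have "\<dots> = h\<^sup>2 - (t * L) * ((1 - t) * L)"
    using up uu by (simp add: inner_diff_left inner_diff_right inner_commute h_def dot_square_norm
        power2_eq_square[of "norm _"] dot_square_norm[unfolded power2_eq_square])
  finally have mn: "(t * L) * ((1 - t) * L) < h\<^sup>2" using acute by simp
  moreover have "0 < (t * L) * ((1 - t) * L)" using t \<open>L > 0\<close> by simp
  ultimately have "h \<noteq> 0" by auto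
  then have "h > 0" by (simp add: h_def)
  then have P: "P = F + h *\<^sub>R v" by (simp add: v_def)
  have "v \<bullet> v = 1"
    using \<open>h > 0\<close> unfolding norm_eq_1[symmetric] by (simp add: v_def h_def)
  moreover have "u \<bullet> v = 0"
    using up by (simp add: v_def)
  moreover have "t * L > 0" "(1 - t) * L > 0"
    using t \<open>L > 0\<close> by simp_all
  ultimately show ?thesis
    using that uu \<open>h > 0\<close> mn P Q R by blast
qed


text \<open>
  The calibrating unit vectors are the directions of the sides of the orthic triangle:
  \<open>e1\<close> from \<open>F\<close> to \<open>X0\<close>, \<open>e2\<close> from \<open>F\<close> to \<open>Y0\<close>, and \<open>e3\<close> from \<open>X0\<close> to \<open>Y0\<close>.  The altitudes of a
  triangle bisect the angles of its orthic triangle (it is a billiard path), which means that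
  \<open>e1 - e3\<close> is normal to \<open>PQ\<close>, that \<open>e2 + e3\<close> is normal to \<open>PR\<close>, and that \<open>e1 + e2\<close> is a positive
  multiple of \<open>P - F\<close>.  The last fact is the reason why \<open>Z\<close> need not lie on \<open>QR\<close>: if it lies beyond
  that line, the lower bound only grows.

  A triple attaining the bound has its sides parallel to those of the orthic triangle and its
  vertices on the three side lines; comparing coordinates leaves only the orthic triangle itself.
\<close>

lemma fagnano_beyond_side:
  fixes P Q R F :: point
  assumes F: "F \<in> open_segment Q R" and perp: "orthogonal (P - F) (R - Q)"
    and acute: "(Q - P) \<bullet> (R - P) > 0"
  obtains X0 Y0 where
    "orthic_triangle P Q R = (X0, Y0, F)" "X0 \<in> closed_segment P Q" "Y0 \<in> closed_segment P R"
    "\<not> collinear {X0, Y0, F}"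
    "\<And>X Y Z. X \<in> affine hull {P, Q} \<Longrightarrow> Y \<in> affine hull {P, R} \<Longrightarrow> (Z - F) \<bullet> (P - F) \<le> 0 \<Longrightarrow>
       (X, Y, Z) \<noteq> (X0, Y0, F) \<Longrightarrow> perimeter (X0, Y0, F) < perimeter (X, Y, Z)"
proof -
  obtain u v h m n where uv: "u \<bullet> u = 1" "v \<bullet> v = 1" "u \<bullet> v = 0"
    and pos: "h > 0" "m > 0" "n > 0" and "m * n < h\<^sup>2"
    and P: "P = F + h *\<^sub>R v" and Q: "Q = F - m *\<^sub>R u" and R: "R = F + n *\<^sub>R u"
    using altitude_frame[OF F perp acute] .
  have vu: "v \<bullet> u = 0" using uv by (simp add: inner_commute)
  note ip = uv vu inner_add_left inner_add_right inner_diff_left inner_diff_right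
  define g where "g = h\<^sup>2 - m * n"
  have "g > 0" using \<open>m * n < h\<^sup>2\<close> by (simp add: g_def)
  define M N where "M = h\<^sup>2 + m\<^sup>2" and "N = h\<^sup>2 + n\<^sup>2"
  have MN: "M > 0" "N > 0" using pos by (simp_all add: M_def N_def add_pos_pos)
  \<comment> \<open>\<open>M\<close> and \<open>N\<close> are the squared lengths of \<open>PQ\<close> and \<open>PR\<close>, so \<open>K\<close> is the product of the lengths.\<close>
  define K where "K = sqrt (M * N)"
  have "K > 0" and KK: "K * K = M * N" using MN by (simp_all add: K_def)
  \<comment> \<open>\<open>e1\<close> and \<open>e2\<close> are mirror images of each other in the altitude.\<close>
  define e1 where "e1 = (1 / K) *\<^sub>R ((h * (m + n)) *\<^sub>R v - g *\<^sub>R u)"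
  define e2 where "e2 = (1 / K) *\<^sub>R ((h * (m + n)) *\<^sub>R v + g *\<^sub>R u)"
  define e3 where "e3 = (1 / K) *\<^sub>R ((h * (n - m)) *\<^sub>R v + (h\<^sup>2 + m * n) *\<^sub>R u)"
  have unit: "norm e1 = 1" "norm e2 = 1" "norm e3 = 1"
  proof -
    have sq: "(h * (m + n)) * (h * (m + n)) + g * g = K * K"
      "(h * (n - m)) * (h * (n - m)) + (h\<^sup>2 + m * n) * (h\<^sup>2 + m * n) = K * K"
      unfolding KK M_def N_def g_def by (simp_all add: algebra_simps power2_eq_square)
    have normalize: "norm ((1 / K) *\<^sub>R w) = 1" if "w \<bullet> w = K * K" for w :: point
      using that \<open>K > 0\<close> unfolding norm_eq_1 by simp
    show "norm e1 = 1" "norm e2 = 1" "norm e3 = 1"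
      unfolding e1_def e2_def e3_def by (rule normalize, use sq in \<open>simp add: ip\<close>)+
  qed
  have coords:
    "e1 \<bullet> v = h * (m + n) / K" "e2 \<bullet> v = h * (m + n) / K" "e3 \<bullet> v = h * (n - m) / K"
    "e1 \<bullet> u = - g / K" "e2 \<bullet> u = g / K" "e3 \<bullet> u = (h\<^sup>2 + m * n) / K"
    by (simp_all add: e1_def e2_def e3_def ip)
  have gM: "(m + n) * m + g = M" and gN: "(m + n) * n + g = N"
    by (simp_all add: g_def M_def N_def algebra_simps power2_eq_square)
  have "1 - g / M = (M - g) / M" "1 - g / N = (N - g) / N"
    using MN by (simp_all add: diff_divide_distrib)
  moreover have "M - g = (m + n) * m" "N - g = (m + n) * n"
    by (simp_all flip: gM gN)
  ultimately have g1: "1 - g / M = (m + n) * m / M" "1 - g / N = (m + n) * n / N"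
    by simp_all
  \<comment> \<open>The feet of the altitudes on \<open>PQ\<close> and \<open>PR\<close>: \<open>g\<close> is the inner product of the two sides at \<open>P\<close>.\<close>
  define X0 Y0 where "X0 = P + (g / M) *\<^sub>R (Q - P)" and "Y0 = P + (g / N) *\<^sub>R (R - P)"
  have comb: "a *\<^sub>R v + b *\<^sub>R u = a' *\<^sub>R v + b' *\<^sub>R u" if "a = a'" "b = b'" for a b a' b'
    using that by simp
  have X0: "X0 - F = (m * K / M) *\<^sub>R e1"
  proof -
    have "X0 - F = (h * (1 - g / M)) *\<^sub>R v + (- (m * g / M)) *\<^sub>R u"
      by (simp add: X0_def P Q algebra_simps)
    also have "\<dots> = (m * K / M * (1 / K) * (h * (m + n))) *\<^sub>R v + (- (m * K / M * (1 / K) * g)) *\<^sub>R u"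
      using \<open>K > 0\<close> g1 by (intro comb) simp_all
    also have "\<dots> = (m * K / M) *\<^sub>R e1"
      by (simp add: e1_def scaleR_diff_right)
    finally show ?thesis .
  qed
  have Y0: "Y0 - F = (n * K / N) *\<^sub>R e2"
  proof -
    have "Y0 - F = (h * (1 - g / N)) *\<^sub>R v + (n * g / N) *\<^sub>R u"
      by (simp add: Y0_def P R algebra_simps)
    also have "\<dots> = (n * K / N * (1 / K) * (h * (m + n))) *\<^sub>R v + (n * K / N * (1 / K) * g) *\<^sub>R u"
      using \<open>K > 0\<close> g1 by (intro comb) simp_all
    also have "\<dots> = (n * K / N) *\<^sub>R e2"
      by (simp add: e2_def scaleR_add_right)
    finally show ?thesis .
  qed
  have Y0X0: "Y0 - X0 = (g * (m + n) / K) *\<^sub>R e3"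
  proof -
    have 1: "h * (g / M - g / N) = g * (m + n) / K * (1 / K) * (h * (n - m))"
    proof -
      have "(N - M) = (m + n) * (n - m)"
        by (simp add: M_def N_def algebra_simps power2_eq_square)
      moreover have "h * (g / M - g / N) = h * g * (N - M) / (M * N)"
        using MN by (simp add: field_simps)
      ultimately show ?thesis
        by (simp add: KK)
    qed
    have 2: "n * g / N + m * g / M = g * (m + n) / K * (1 / K) * (h\<^sup>2 + m * n)"
    proof -
      have "n * M + m * N = (m + n) * (h\<^sup>2 + m * n)"
        by (simp add: M_def N_def algebra_simps power2_eq_square)
      moreover have "n * g / N + m * g / M = g * (n * M + m * N) / (M * N)"
        using MN by (simp add: field_simps)
      ultimately show ?thesis
        by (simp add: KK)
    qed
    have "Y0 - X0 = (h * (g / M - g / N)) *\<^sub>R v + (n * g / N + m * g / M) *\<^sub>R u"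
      by (simp add: Y0_def X0_def P Q R algebra_simps)
    also have "\<dots> = (g * (m + n) / K) *\<^sub>R e3"
      unfolding 1 2 by (simp add: e3_def scaleR_add_right)
    finally show ?thesis .
  qed
  have e12: "e1 + e2 = (2 * h * (m + n) / K) *\<^sub>R v"
  proof -
    have "e1 + e2 = (1 / K) *\<^sub>R ((h * (m + n)) *\<^sub>R v + (h * (m + n)) *\<^sub>R v)"
      by (simp add: e1_def e2_def scaleR_add_right scaleR_diff_right)
    then show ?thesis
      by (simp flip: scaleR_left_distrib)
  qed
  define k where "k = 2 * h"
  have e13: "e1 - e3 = (k / K) *\<^sub>R (m *\<^sub>R v - h *\<^sub>R u)"
  proof -
    have "e1 - e3 = (1 / K) *\<^sub>R ((h * (m + n) - h * (n - m)) *\<^sub>R v - (g + (h\<^sup>2 + m * n)) *\<^sub>R u)"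
      unfolding e1_def e3_def scaleR_diff_right[symmetric] scaleR_diff_left scaleR_add_left
      by (rule arg_cong[of _ _ "(*\<^sub>R) (1 / K)"]) simp
    moreover have "h * (m + n) - h * (n - m) = k * m" "g + (h\<^sup>2 + m * n) = k * h"
      by (simp_all add: g_def k_def algebra_simps power2_eq_square)
    ultimately show ?thesis
      by (simp add: scaleR_diff_right)
  qed
  have e23: "e2 + e3 = (k / K) *\<^sub>R (n *\<^sub>R v + h *\<^sub>R u)"
  proof -
    have "e2 + e3 = (1 / K) *\<^sub>R ((h * (m + n) + h * (n - m)) *\<^sub>R v + (g + (h\<^sup>2 + m * n)) *\<^sub>R u)"
      unfolding e2_def e3_def scaleR_add_right[symmetric] scaleR_add_left
      by (rule arg_cong[of _ _ "(*\<^sub>R) (1 / K)"]) simp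
    moreover have "h * (m + n) + h * (n - m) = k * n" "g + (h\<^sup>2 + m * n) = k * h"
      by (simp_all add: g_def k_def algebra_simps power2_eq_square)
    ultimately show ?thesis
      by (simp add: scaleR_add_right)
  qed
  have PQ: "(X - P) \<bullet> (e1 - e3) = 0" if "X \<in> affine hull {P, Q}" for X
    using that by (auto simp: affine_hull_2_param e13 P Q ip)
  have PR: "(Y - P) \<bullet> (e2 + e3) = 0" if "Y \<in> affine hull {P, R}" for Y
    using that by (auto simp: affine_hull_2_param e23 P R ip)
  have X0_line: "X0 \<in> affine hull {P, Q}" and Y0_line: "Y0 \<in> affine hull {P, R}"
    by (auto simp: affine_hull_2_param X0_def Y0_def)
  have "perimeter (X0, Y0, F) = (X0 - F) \<bullet> e1 + (Y0 - X0) \<bullet> e3 + (Y0 - F) \<bullet> e2"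
  proof -
    have "w \<bullet> e = norm w" if "w = c *\<^sub>R e" "c > 0" "norm e = 1" for w e :: point and c
      using that by (simp add: norm_eq_1)
    from this[OF X0] this[OF Y0] this[OF Y0X0] show ?thesis
      using pos MN \<open>K > 0\<close> \<open>g > 0\<close> unit by (simp add: dist_norm norm_minus_commute)
  qed
  also have "\<dots> = (P - F) \<bullet> (e1 + e2)"
    using PQ[OF X0_line] PR[OF Y0_line]
    by (simp add: inner_diff_left inner_diff_right inner_add_right)
  finally have per0: "perimeter (X0, Y0, F) = (P - F) \<bullet> (e1 + e2)" .
  show ?thesis
  proof (rule that)
    have "(Q - P) \<bullet> (R - P) = g" "(Q - P) \<bullet> (Q - P) = M" "(R - P) \<bullet> (R - P) = N"
      by (simp_all add: P Q R ip g_def M_def N_def power2_eq_square)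
    moreover have "R - X0 = (R - P) - (g / M) *\<^sub>R (Q - P)" "Q - Y0 = (Q - P) - (g / N) *\<^sub>R (R - P)"
      by (simp_all add: X0_def Y0_def)
    ultimately have "orthogonal (R - X0) (Q - P)" "orthogonal (Q - Y0) (R - P)"
      using MN unfolding orthogonal_def by (simp_all only: inner_diff_left[of "_ - P"])
        (simp_all add: inner_commute)
    moreover have "P \<noteq> Q" "P \<noteq> R" "Q \<noteq> R"
      using acute F by auto
    moreover have "F \<in> affine hull {Q, R}"
      using F open_closed_segment convex_hull_subset_affine_hull by (fastforce simp: segment_convex_hull)
    ultimately show "orthic_triangle P Q R = (X0, Y0, F)"
      using X0_line Y0_line perp by (simp add: orthic_triangle_def foot_eqI)
    have "g \<le> M" "g \<le> N"
      using pos by (simp_all flip: gM gN)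
    then have "0 \<le> g / M" "g / M \<le> 1" "0 \<le> g / N" "g / N \<le> 1"
      using \<open>g > 0\<close> MN by simp_all
    then show "X0 \<in> closed_segment P Q" "Y0 \<in> closed_segment P R"
      unfolding X0_def Y0_def by (auto simp: closed_segment_param)
    show "\<not> collinear {X0, Y0, F}"
    proof
      assume "collinear {X0, Y0, F}"
      then have "collinear {0, X0 - F, Y0 - F}"
        using collinear_3[of X0 F Y0] by (auto simp: insert_commute)
      moreover have "X0 - F \<noteq> 0" "Y0 - F \<noteq> 0"
        unfolding X0 Y0 using unit pos MN \<open>K > 0\<close> by auto
      ultimately obtain c where c: "Y0 - F = c *\<^sub>R (X0 - F)"
        by (auto simp: collinear_lemma)
      define p q where "p = m * K / M" and "q = n * K / N"
      have "q * (e2 \<bullet> v) = c * p * (e1 \<bullet> v)" "q * (e2 \<bullet> u) = c * p * (e1 \<bullet> u)"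
        using arg_cong[OF c, of "\<lambda>x. x \<bullet> v"] arg_cong[OF c, of "\<lambda>x. x \<bullet> u"]
        unfolding X0 Y0 p_def[symmetric] q_def[symmetric] by simp_all
      then have "q * (h * (m + n) / K) = (c * p) * (h * (m + n) / K)" "q * (g / K) = - (c * p) * (g / K)"
        by (simp_all add: coords)
      moreover have "h * (m + n) / K \<noteq> 0" "g / K \<noteq> 0"
        using pos \<open>g > 0\<close> \<open>K > 0\<close> by simp_all
      ultimately have "q = c * p" "q = - (c * p)"
        by (metis mult_right_cancel)+
      then have "q = 0"
        by linarith
      then show False
        using pos MN \<open>K > 0\<close> by (simp add: q_def)
    qed
  next
    fix X Y Z
    assume X: "X \<in> affine hull {P, Q}" and Y: "Y \<in> affine hull {P, R}"
      and "(Z - F) \<bullet> (P - F) \<le> 0" and ne: "(X, Y, Z) \<noteq> (X0, Y0, F)"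
    then have Z: "(Z - F) \<bullet> (e1 + e2) \<le> 0"
      using pos \<open>K > 0\<close> by (simp add: e12 P mult_le_0_iff zero_le_mult_iff divide_le_0_iff)
    have False if eq: "perimeter (X, Y, Z) = (P - F) \<bullet> (e1 + e2)"
    proof -
      obtain a b c where XZ: "X - Z = a *\<^sub>R e1" and YZ: "Y - Z = b *\<^sub>R e2" and YX: "Y - X = c *\<^sub>R e3"
        and Z0: "(Z - F) \<bullet> (e1 + e2) = 0"
        using calibrated_perimeter(2)[OF unit PQ[OF X] PR[OF Y] Z eq] by blast
      obtain t s where t: "X = P + t *\<^sub>R (Q - P)" and s: "Y = P + s *\<^sub>R (R - P)"
        using X Y by (auto simp: affine_hull_2_param)
      have Zv: "Z \<bullet> v = F \<bullet> v"
        using Z0 pos \<open>K > 0\<close> by (simp add: e12 inner_diff_left)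
      \<comment> \<open>Coordinates of the three sides, to be compared with those of \<open>e1\<close>, \<open>e2\<close> and \<open>e3\<close>.\<close>
      have inner: "(X - Z) \<bullet> v = (1 - t) * h" "(Y - Z) \<bullet> v = (1 - s) * h" "(Y - X) \<bullet> v = (t - s) * h"
        "(X - Z) \<bullet> u = - (t * m + (Z - F) \<bullet> u)" "(Y - Z) \<bullet> u = s * n - (Z - F) \<bullet> u"
        "(Y - X) \<bullet> u = s * n + t * m"
        using Zv by (simp_all add: t s P Q R ip algebra_simps)
      have "(1 - t) * h = a * (h * (m + n) / K)" "(1 - s) * h = b * (h * (m + n) / K)"
        "(t - s) * h = c * (h * (n - m) / K)" "t * m + (Z - F) \<bullet> u = a * (g / K)"
        "s * n - (Z - F) \<bullet> u = b * (g / K)" "s * n + t * m = c * ((h\<^sup>2 + m * n) / K)"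
        using inner unfolding XZ YZ YX by (simp_all add: coords)
      then have a: "(1 - t) * K = a * (m + n)" and b: "(1 - s) * K = b * (m + n)"
        and cv: "(t - s) * K = c * (n - m)" and au: "(t * m + (Z - F) \<bullet> u) * K = a * g"
        and bu: "(s * n - (Z - F) \<bullet> u) * K = b * g" and cu: "(s * n + t * m) * K = c * (h\<^sup>2 + m * n)"
        using pos \<open>K > 0\<close> by (simp_all add: eq_divide_eq)
      \<comment> \<open>Eliminating \<open>c\<close> gives one linear equation for \<open>s\<close> and \<open>t\<close>, eliminating \<open>a\<close> and \<open>b\<close> another.\<close>
      have "K * (t * M - s * N) = 0"
        using cu cv unfolding M_def N_def by algebra
      then have ts: "t * M = s * N" using \<open>K > 0\<close> by simp
      have "K * ((t * m + s * n) * (m + n)) = K * ((2 - t - s) * g)"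
        using a b au bu by algebra
      then have "(t * m + s * n) * (m + n) = (2 - t - s) * g" using \<open>K > 0\<close> by simp
      then have "t * M + s * N = 2 * g"
        unfolding gM[symmetric] gN[symmetric] by (simp add: algebra_simps)
      with ts have tM: "t = g / M" "s = g / N" using MN by (simp_all add: field_simps)
      then have "X = X0" "Y = Y0" by (simp_all add: t s X0_def Y0_def)
      have "a * (m + n) = (m * K / M) * (m + n)"
        unfolding a[symmetric] tM g1 by simp
      moreover have "m + n \<noteq> 0"
        using pos by simp
      ultimately have "a = m * K / M"
        by (metis mult_right_cancel)
      then have "X0 - Z = X0 - F"
        using XZ X0 \<open>X = X0\<close> by simp
      then have "Z = F"
        by simp
      with \<open>X = X0\<close> \<open>Y = Y0\<close> ne show False by simp
    qed
    then show "perimeter (X0, Y0, F) < perimeter (X, Y, Z)"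
      using calibrated_perimeter(1)[OF unit PQ[OF X] PR[OF Y] Z] unfolding per0 by force
  qed
qed

section \<open>Orthic triangles inscribed in the quadrangle\<close>

lemma acute_angle_foot_inside:
  fixes A B C :: "'a::real_inner"
  assumes B: "(A - B) \<bullet> (C - B) > 0" and C: "(A - C) \<bullet> (B - C) > 0"
  obtains F where "F \<in> open_segment B C" "orthogonal (A - F) (C - B)"
proof -
  define t where "t = ((A - B) \<bullet> (C - B)) / ((C - B) \<bullet> (C - B))"
  define F where "F = B + t *\<^sub>R (C - B)"
  have "B \<noteq> C" using B by auto
  then have pos: "(C - B) \<bullet> (C - B) > 0" by simp
  have "(A - C) \<bullet> (B - C) = (C - B) \<bullet> (C - B) - (A - B) \<bullet> (C - B)"
    by (simp add: inner_diff_left inner_diff_right inner_commute)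
  then have t: "0 < t" "t < 1"
    using B C pos by (simp_all add: t_def)
  have "F = (1 - t) *\<^sub>R B + t *\<^sub>R C"
    by (simp add: F_def algebra_simps)
  then have "F \<in> open_segment B C"
    using t \<open>B \<noteq> C\<close> by (auto simp: in_segment)
  moreover have "(A - F) \<bullet> (C - B) = (A - B) \<bullet> (C - B) - t * ((C - B) \<bullet> (C - B))"
    by (simp add: F_def inner_diff_left inner_add_left algebra_simps)
  then have "orthogonal (A - F) (C - B)"
    using pos by (simp add: orthogonal_def t_def)
  ultimately show ?thesis ..
qed

text \<open>
  If the foot of the altitude lies strictly between \<open>Q\<close> and \<open>R\<close>, both angles at the base are
  acute, so only the angle at the apex has to be assumed acute.
\<close>

lemma acute_triangle_of_inner_foot:
  fixes P Q R F :: point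
  assumes F: "F \<in> open_segment Q R" and perp: "orthogonal (P - F) (R - Q)"
    and acute: "(Q - P) \<bullet> (R - P) > 0"
  shows "acute_triangle P Q R"
proof (rule acute_triangleI[OF acute])
  obtain u v h m n where "u \<bullet> u = 1" "v \<bullet> v = 1" "u \<bullet> v = 0" "h > 0" "m > 0" "n > 0"
    "m * n < h\<^sup>2" "P = F + h *\<^sub>R v" "Q = F - m *\<^sub>R u" "R = F + n *\<^sub>R u"
    using altitude_frame[OF F perp acute] .
  then show "(P - Q) \<bullet> (R - Q) > 0" "(Q - R) \<bullet> (P - R) > 0"
    by (simp_all add: inner_diff_left inner_diff_right inner_add_left inner_add_right
        inner_commute add_pos_pos)
qed

lemma closed_segment_subset_halfspace:
  fixes X Y F w :: "'a::real_inner"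
  assumes "(X - F) \<bullet> w \<le> 0" "(Y - F) \<bullet> w \<le> 0" "Z \<in> closed_segment X Y"
  shows "(Z - F) \<bullet> w \<le> 0"
proof -
  have "{Z. (Z - F) \<bullet> w \<le> 0} = {Z. w \<bullet> Z \<le> w \<bullet> F}"
    by (auto simp: inner_diff_left inner_commute[of w])
  then have "convex {Z. (Z - F) \<bullet> w \<le> 0}"
    by (simp add: convex_halfspace_le)
  then have "closed_segment X Y \<subseteq> {Z. (Z - F) \<bullet> w \<le> 0}"
    using assms by (intro closed_segment_subset) auto
  then show ?thesis
    using assms(3) by blast
qed

lemma closed_segment_subset_line:
  fixes A E S :: "'a::real_vector"
  assumes S: "S \<in> closed_segment A E" "S \<noteq> A"
  shows "closed_segment A E \<subseteq> affine hull {A, S}"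
proof
  fix X assume "X \<in> closed_segment A E"
  then obtain x where x: "X = A + x *\<^sub>R (E - A)"
    by (auto simp: closed_segment_param)
  obtain s where s: "S = A + s *\<^sub>R (E - A)"
    using S(1) by (auto simp: closed_segment_param)
  have "X = A + (x / s) *\<^sub>R (S - A)"
    using s x S(2) by auto
  then show "X \<in> affine hull {A, S}"
    by (auto simp: affine_hull_2_param)
qed

text \<open>
  The common part of both cases of the theorem.  A triangle \<open>AQR\<close> is cut off at the corner \<open>A\<close> of
  the quadrangle in such a way that the broken line \<open>BCD\<close> contains the foot \<open>F\<close> of the altitude
  and nowhere crosses the line \<open>QR\<close> to the side of \<open>A\<close>.  Since \<open>Q\<close>
  and \<open>R\<close> lie on the sides of the quadrangle, all competing triangles are covered by the extended
  form of Fagnano's problem.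
\<close>

lemma orthic_triangle_minimal:
  fixes A B C D Q R F :: point
  assumes Q: "Q \<in> closed_segment A B" and R: "R \<in> closed_segment A D"
    and F: "F \<in> open_segment Q R" "orthogonal (A - F) (R - Q)"
    and A: "(Q - A) \<bullet> (R - A) > 0"
    and F_mem: "F \<in> closed_segment B C \<union> closed_segment C D"
    and beyond: "(B - F) \<bullet> (A - F) \<le> 0" "(C - F) \<bullet> (A - F) \<le> 0" "(D - F) \<bullet> (A - F) \<le> 0"
  shows "acute_triangle A Q R" "minimal_perimeter_triangle A B C D (orthic_triangle A Q R)"
proof -
  show "acute_triangle A Q R"
    using F A by (rule acute_triangle_of_inner_foot)
  obtain X0 Y0 where orthic: "orthic_triangle A Q R = (X0, Y0, F)"
    and X0: "X0 \<in> closed_segment A Q" and Y0: "Y0 \<in> closed_segment A R"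
    and nondeg: "\<not> collinear {X0, Y0, F}"
    and min: "\<And>X Y Z. X \<in> affine hull {A, Q} \<Longrightarrow> Y \<in> affine hull {A, R} \<Longrightarrow>
       (Z - F) \<bullet> (A - F) \<le> 0 \<Longrightarrow> (X, Y, Z) \<noteq> (X0, Y0, F) \<Longrightarrow>
       perimeter (X0, Y0, F) < perimeter (X, Y, Z)"
    using fagnano_beyond_side[OF F A] by blast
  have "Q \<noteq> A" "R \<noteq> A"
    using A by auto
  then have sides: "closed_segment A B \<subseteq> affine hull {A, Q}" "closed_segment A D \<subseteq> affine hull {A, R}"
    using Q R by (simp_all add: closed_segment_subset_line)
  have "X0 \<in> closed_segment A B" "Y0 \<in> closed_segment A D"
    using X0 Y0 Q R by (meson ends_in_segment subset_closed_segment subsetD)+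
  then show "minimal_perimeter_triangle A B C D (orthic_triangle A Q R)"
    unfolding minimal_perimeter_triangle_def competing_triangles_def orthic
    using F_mem nondeg sides closed_segment_subset_halfspace[OF beyond(1,2)]
      closed_segment_subset_halfspace[OF beyond(2,3)]
    by (auto intro!: min simp del: perimeter.simps)
qed

section \<open>The perpendicular at the reflex vertex\<close>

text \<open>
  The perpendicular to \<open>AC\<close> at \<open>C\<close> meets the segment from \<open>A\<close> to \<open>B\<close> exactly if \<open>B\<close> is not on the
  same side of it as \<open>A\<close>.  This and the next lemma are the two directions.
\<close>

lemma orthogonal_line_meets_segment:
  fixes A B C :: "'a::real_inner"
  assumes "(B - C) \<bullet> (A - C) \<le> 0"
  shows "\<exists>P \<in> closed_segment A B. orthogonal (P - C) (A - C)"
proof -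
  define a b where "a = (A - C) \<bullet> (A - C)" and "b = (B - C) \<bullet> (A - C)"
  have P: "(A + t *\<^sub>R (B - A) - C) \<bullet> (A - C) = a - t * (a - b)" for t
    by (simp add: a_def b_def inner_diff_left inner_add_left algebra_simps)
  have "a \<ge> 0" "b \<le> 0" using assms by (simp_all add: a_def b_def)
  define t where "t = a / (a - b)"
  have "0 \<le> t" "t \<le> 1" "a - t * (a - b) = 0"
    using \<open>a \<ge> 0\<close> \<open>b \<le> 0\<close> by (auto simp: t_def divide_le_eq_1)
  then show ?thesis
    using P[of t] unfolding orthogonal_def
    by (intro bexI[of _ "A + t *\<^sub>R (B - A)"]) (auto simp: closed_segment_param)
qed

lemma orthogonal_line_crosses_segment:
  fixes A B C M :: "'a::real_inner"
  assumes M: "M \<in> closed_segment A B" and perp: "orthogonal (M - C) (A - C)"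
  shows "(B - C) \<bullet> (A - C) \<le> 0"
proof -
  obtain t where t: "0 \<le> t" "t \<le> 1" "M = (1 - t) *\<^sub>R A + t *\<^sub>R B"
    using M by (auto simp: in_segment)
  then have "M - C = (1 - t) *\<^sub>R (A - C) + t *\<^sub>R (B - C)"
    by (simp add: algebra_simps)
  then have eq: "(1 - t) * ((A - C) \<bullet> (A - C)) + t * ((B - C) \<bullet> (A - C)) = 0"
    using perp by (simp add: orthogonal_def inner_add_left)
  show ?thesis
  proof (rule ccontr)
    assume "\<not> ?thesis"
    then have "A \<noteq> C" "(B - C) \<bullet> (A - C) > 0" by auto
    then show False
      using eq t by (smt (verit) inner_gt_zero_iff mult_nonneg_nonneg mult_pos_pos right_minus_eq)
  qed
qed

lemma noncollinear_coordinates_unique: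
  fixes b d :: "'a::euclidean_space"
  assumes "\<not> collinear {0, b, d}" "p *\<^sub>R b + q *\<^sub>R d = p' *\<^sub>R b + q' *\<^sub>R d"
  shows "p = p' \<and> q = q'"
proof (rule ccontr)
  assume "\<not> ?thesis"
  moreover have eq: "(p - p') *\<^sub>R b = (q' - q) *\<^sub>R d"
    using assms(2) by (simp add: algebra_simps)
  moreover have "b \<noteq> 0" "d \<noteq> 0"
    using assms(1) by (auto simp: collinear_lemma)
  ultimately have "q' - q \<noteq> 0" by auto
  then have "d = ((p - p') / (q' - q)) *\<^sub>R b"
    using eq by (metis divide_inverse_commute scaleR_left.minus scaleR_one scaleR_scaleR left_inverse)
  then show False
    using assms(1) by (auto simp: collinear_lemma)
qed

text \<open>
  Eliminating the coefficient of \<open>B - A\<close>: the line through \<open>B\<close> and \<open>C\<close> reaches the line \<open>AD\<close> after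
  \<open>1 / (1 - y)\<close> times the step from \<open>B\<close> to \<open>C\<close>.
\<close>

lemma prolongation_meets_side:
  fixes A B C D :: point
  assumes yz: "y > 0" "z > 0" "y + z < 1" and C: "C = A + y *\<^sub>R (B - A) + z *\<^sub>R (D - A)"
    and ncol: "\<not> collinear {0, B - A, D - A}"
  shows "prolongation B C \<inter> closed_segment A D = {A + (z / (1 - y)) *\<^sub>R (D - A)}"
proof -
  have "C \<in> open_segment B W \<longleftrightarrow> w = z / (1 - y)" if W: "W = A + w *\<^sub>R (D - A)" for w W
  proof -
    have mix: "(1 - k) *\<^sub>R B + k *\<^sub>R W = A + (1 - k) *\<^sub>R (B - A) + (k * w) *\<^sub>R (D - A)" for k
      by (simp add: W algebra_simps)
    have "B \<noteq> W"
    proof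
      assume "B = W"
      then have "1 *\<^sub>R (B - A) + 0 *\<^sub>R (D - A) = 0 *\<^sub>R (B - A) + w *\<^sub>R (D - A)"
        by (simp add: W)
      from noncollinear_coordinates_unique[OF ncol this] show False by simp
    qed
    then have "C \<in> open_segment B W \<longleftrightarrow> (\<exists>k. 0 < k \<and> k < 1 \<and> C = (1 - k) *\<^sub>R B + k *\<^sub>R W)"
      by (auto simp: in_segment)
    also have "\<dots> \<longleftrightarrow> (\<exists>k. 0 < k \<and> k < 1 \<and> y = 1 - k \<and> z = k * w)"
      unfolding mix C using noncollinear_coordinates_unique[OF ncol]
      by (metis (no_types, lifting) add.assoc add_left_cancel)
    also have "\<dots> \<longleftrightarrow> z = (1 - y) * w"
    proof
      assume "z = (1 - y) * w"
      then show "\<exists>k. 0 < k \<and> k < 1 \<and> y = 1 - k \<and> z = k * w"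
        using yz by (intro exI[of _ "1 - y"]) auto
    qed auto
    also have "\<dots> \<longleftrightarrow> w = z / (1 - y)"
      using yz by (auto simp: field_simps)
    finally show ?thesis .
  qed
  moreover have "\<exists>w. W = A + w *\<^sub>R (D - A)" if "W \<in> closed_segment A D" for W
    using that by (auto simp: closed_segment_param)
  moreover have "A + (z / (1 - y)) *\<^sub>R (D - A) \<in> closed_segment A D"
    using yz unfolding closed_segment_param by (intro exI[of _ "z / (1 - y)"]) auto
  ultimately show ?thesis
    unfolding prolongation_def by blast
qed

text \<open>
  If the perpendicular misses \<open>AB\<close>, the triangle \<open>ABC\<close> has an acute angle at \<open>C\<close>; its angle at \<open>B\<close>
  is an angle of the quadrangle and acute as well.  So the altitude of \<open>ABW\<close> from \<open>A\<close> ends on the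
  side \<open>BC\<close> itself, not merely on its prolongation.  The points \<open>B\<close> and \<open>C\<close> lie on the line \<open>BW\<close>, and
  \<open>D\<close> lies on or beyond it, because \<open>W\<close> is on the way from \<open>A\<close> to \<open>D\<close>.
\<close>

lemma altitude_to_prolonged_side:
  fixes A B C D :: point
  assumes yz: "y > 0" "z > 0" "y + z < 1" and C: "C = A + y *\<^sub>R (B - A) + z *\<^sub>R (D - A)"
    and ncol: "\<not> collinear {0, B - A, D - A}"
    and A: "(B - A) \<bullet> (D - A) > 0" and B: "(A - B) \<bullet> (C - B) > 0"
    and misses: "perpendicular_at A C \<inter> closed_segment A B = {}"
  obtains W F where "prolongation B C \<inter> closed_segment A D = {W}" "(B - A) \<bullet> (W - A) > 0"
    "F \<in> open_segment B W" "F \<in> closed_segment B C" "orthogonal (A - F) (W - B)"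
    "(B - F) \<bullet> (A - F) \<le> 0" "(C - F) \<bullet> (A - F) \<le> 0" "(D - F) \<bullet> (A - F) \<le> 0"
proof -
  define w where "w = z / (1 - y)"
  define W where "W = A + w *\<^sub>R (D - A)"
  have W: "prolongation B C \<inter> closed_segment A D = {W}"
    unfolding W_def w_def by (rule prolongation_meets_side[OF yz C ncol])
  have "w > 0" using yz by (simp add: w_def)
  have WB: "C - B = (1 - y) *\<^sub>R (W - B)"
  proof -
    have z: "z = (1 - y) * w" using yz by (simp add: w_def)
    show ?thesis unfolding C W_def z by (simp add: algebra_simps)
  qed
  have "(B - C) \<bullet> (A - C) > 0"
  proof (rule ccontr)
    assume "\<not> ?thesis"
    then obtain P where "P \<in> closed_segment A B" "orthogonal (P - C) (A - C)"
      using orthogonal_line_meets_segment[of B C A] by auto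
    then show False
      using misses by (auto simp: perpendicular_at_def)
  qed
  then obtain F where F: "F \<in> open_segment B C" and perp: "orthogonal (A - F) (C - B)"
    using acute_angle_foot_inside[OF B] by (metis inner_commute)
  obtain t where t: "0 < t" "t < 1" and Ft: "F = (1 - t) *\<^sub>R B + t *\<^sub>R C"
    using F by (auto simp: in_segment)
  have perpW: "(W - B) \<bullet> (A - F) = 0"
    using perp yz by (simp add: WB orthogonal_def inner_commute)
  have FB: "F - B = (t * (1 - y)) *\<^sub>R (W - B)"
    unfolding scaleR_scaleR[symmetric] WB[symmetric] by (simp add: Ft algebra_simps)
  have onBW: "(P - F) \<bullet> (A - F) = 0" if "P - B = k *\<^sub>R (W - B)" for P k
  proof -
    have "P - F = k *\<^sub>R (W - B) - (t * (1 - y)) *\<^sub>R (W - B)"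
      by (simp flip: that FB)
    then show ?thesis
      using perpW by (simp add: inner_diff_left)
  qed
  show ?thesis
  proof (rule that[OF W])
    show "(B - A) \<bullet> (W - A) > 0"
      using A \<open>w > 0\<close> by (simp add: W_def)
    have "B \<noteq> W" using WB F by auto
    moreover have "t * (1 - y) < 1" "t * (1 - y) > 0"
      using t yz mult_strict_mono[of t 1 "1 - y" 1] by auto
    moreover have "F = (1 - t * (1 - y)) *\<^sub>R B + (t * (1 - y)) *\<^sub>R W"
      using FB by (simp add: algebra_simps)
    ultimately show "F \<in> open_segment B W"
      unfolding in_segment by blast
    show "F \<in> closed_segment B C"
      using F open_closed_segment by blast
    show "orthogonal (A - F) (W - B)"
      using perpW by (simp add: orthogonal_def inner_commute)
    show "(B - F) \<bullet> (A - F) \<le> 0" "(C - F) \<bullet> (A - F) \<le> 0"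
      using onBW[of B 0] onBW[OF WB] by simp_all
    have "W \<in> closed_segment A D" using W by blast
    moreover have "orthogonal (W - F) (A - F)"
      using onBW[of W 1] by (simp add: orthogonal_def)
    ultimately show "(D - F) \<bullet> (A - F) \<le> 0"
      by (rule orthogonal_line_crosses_segment)
  qed
qed

text \<open>
  \<open>M\<close> and \<open>N\<close> lie on rays from \<open>A\<close> and \<open>C\<close> lies inside the angle between them, so \<open>C\<close>, being on the
  line \<open>MN\<close>, lies between them.  In coefficients: pairing \<open>C - A = (y / m) (M - A) + (z / n) (N - A)\<close>
  with \<open>C - A\<close> shows that the two coefficients add up to 1.
\<close>

lemma perpendicular_chord_through_vertex:
  fixes A B C D M N :: point
  assumes yz: "y > 0" "z > 0" and C: "C = A + y *\<^sub>R (B - A) + z *\<^sub>R (D - A)" and "C \<noteq> A"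
    and A: "(B - A) \<bullet> (D - A) > 0" and ncol: "\<not> collinear {0, B - A, D - A}"
    and M: "M \<in> closed_segment A B" "orthogonal (M - C) (A - C)"
    and N: "N \<in> closed_segment A D" "orthogonal (N - C) (A - C)"
  shows "C \<in> open_segment M N" "(M - A) \<bullet> (N - A) > 0"
proof -
  obtain m n where m: "0 \<le> m" "M = A + m *\<^sub>R (B - A)" and n: "0 \<le> n" "N = A + n *\<^sub>R (D - A)"
    using M(1) N(1) by (auto simp: closed_segment_param)
  define k where "k = (C - A) \<bullet> (C - A)"
  have "k > 0" using \<open>C \<noteq> A\<close> by (simp add: k_def)
  have perp: "(P - A) \<bullet> (C - A) = k" if "orthogonal (P - C) (A - C)" for P
    using that by (simp add: orthogonal_def k_def inner_diff_left inner_diff_right inner_commute)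
  have mk: "m * ((B - A) \<bullet> (C - A)) = k" and nk: "n * ((D - A) \<bullet> (C - A)) = k"
    using perp[OF M(2)] perp[OF N(2)] by (simp_all add: m n)
  then have "m \<noteq> 0" "n \<noteq> 0" using \<open>k > 0\<close> by auto
  then have mn: "m > 0" "n > 0" using m n by simp_all
  show "(M - A) \<bullet> (N - A) > 0"
    using A mn by (simp add: m n)
  have "C - A = y *\<^sub>R (B - A) + z *\<^sub>R (D - A)" by (simp add: C)
  then have "k = y * ((B - A) \<bullet> (C - A)) + z * ((D - A) \<bullet> (C - A))"
    unfolding k_def by (metis inner_add_left inner_scaleR_left)
  also have "(B - A) \<bullet> (C - A) = k / m"
    using mn mk by (simp add: field_simps)
  also have "(D - A) \<bullet> (C - A) = k / n"
    using mn nk by (simp add: field_simps)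
  finally have "k = (y / m + z / n) * k"
    by (simp add: distrib_right)
  then have sum1: "y / m = 1 - z / n"
    using \<open>k > 0\<close> by simp
  have "C = A + (y / m) *\<^sub>R (M - A) + (z / n) *\<^sub>R (N - A)"
    using mn by (simp add: C m n)
  also have "\<dots> = (1 - z / n) *\<^sub>R M + (z / n) *\<^sub>R N"
    unfolding sum1 by (simp add: algebra_simps)
  finally have "C = (1 - z / n) *\<^sub>R M + (z / n) *\<^sub>R N" .
  moreover have "M \<noteq> N"
  proof
    assume "M = N"
    then have "m *\<^sub>R (B - A) + 0 *\<^sub>R (D - A) = 0 *\<^sub>R (B - A) + n *\<^sub>R (D - A)"
      by (simp add: m n)
    from noncollinear_coordinates_unique[OF ncol this] show False
      using mn by simp
  qed
  moreover have "0 < z / n" "0 < y / m"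
    using mn yz by simp_all
  then have "0 < z / n" "z / n < 1"
    unfolding sum1 by simp_all
  ultimately show "C \<in> open_segment M N"
    unfolding in_segment by blast
qed

section \<open>The minimal triangle\<close>

theorem theorem4p1:
  fixes A B C D :: point
  assumes "quadrangle A B C D"
    and "interior_angle (quadrangle_interior A B C D) B C D > pi"
    and "interior_angle (quadrangle_interior A B C D) D A B < pi / 2"
    and "interior_angle (quadrangle_interior A B C D) A B C < pi / 2"
    and "interior_angle (quadrangle_interior A B C D) C D A < pi / 2"
  shows
    "(\<forall>M N. M \<in> perpendicular_at A C \<inter> closed_segment A B \<and>
                  N \<in> perpendicular_at A C \<inter> closed_segment A D \<longrightarrow>
              acute_triangle A M N \<and>
              minimal_perimeter_triangle A B C D (orthic_triangle A M N)) \<and>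
     (perpendicular_at A C \<inter> closed_segment A B = {} \<longrightarrow>
              (\<exists>W. prolongation B C \<inter> closed_segment A D = {W} \<and>
                   acute_triangle A B W \<and>
                   minimal_perimeter_triangle A B C D (orthic_triangle A B W))) \<and>
     (perpendicular_at A C \<inter> closed_segment A D = {} \<longrightarrow>
              (\<exists>W. prolongation D C \<inter> closed_segment A B = {W} \<and>
                   acute_triangle A W D \<and>
                   minimal_perimeter_triangle A B C D (orthic_triangle A W D)))"
proof (intro conjI allI impI)
  obtain y z where yz: "y > 0" "z > 0" "y + z < 1"
    and C: "C = A + y *\<^sub>R (B - A) + z *\<^sub>R (D - A)" and ncol: "\<not> collinear {0, B - A, D - A}"
    using triangle_interior_coordinates[OF reflex_vertex_in_triangle[OF assms(2)]] .
  have angle_A: "(B - A) \<bullet> (D - A) > 0" and angle_B: "(A - B) \<bullet> (C - B) > 0"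
    and angle_D: "(A - D) \<bullet> (C - D) > 0"
    using assms(3-5)[THEN interior_angle_acute_imp_inner_pos] by (simp_all add: inner_commute)
  {
    fix M N
    assume MN: "M \<in> perpendicular_at A C \<inter> closed_segment A B \<and>
      N \<in> perpendicular_at A C \<inter> closed_segment A D"
    then have M: "M \<in> closed_segment A B" "orthogonal (M - C) (A - C)"
      and N: "N \<in> closed_segment A D" "orthogonal (N - C) (A - C)"
      by (auto simp: perpendicular_at_def)
    have "C \<noteq> A"
    proof
      assume "C = A"
      then have "y *\<^sub>R (B - A) + z *\<^sub>R (D - A) = 0 *\<^sub>R (B - A) + 0 *\<^sub>R (D - A)"
        using C by simp
      from noncollinear_coordinates_unique[OF ncol this] show False
        using yz by simp
    qed
    note chord = perpendicular_chord_through_vertex[OF yz(1,2) C \<open>C \<noteq> A\<close> angle_A ncol M N]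
    have "N - M = (N - C) - (M - C)" by simp
    then have perp: "orthogonal (A - C) (N - M)"
      using M(2) N(2) unfolding orthogonal_def by (metis inner_commute inner_diff_left diff_0_right)
    have C_beyond: "(C - C) \<bullet> (A - C) \<le> 0" and C_mem: "C \<in> closed_segment B C \<union> closed_segment C D"
      by simp_all
    show "acute_triangle A M N" "minimal_perimeter_triangle A B C D (orthic_triangle A M N)"
      using orthic_triangle_minimal[OF M(1) N(1) chord(1) perp chord(2) C_mem
          orthogonal_line_crosses_segment[OF M] C_beyond orthogonal_line_crosses_segment[OF N]] .
  }
  {
    assume "perpendicular_at A C \<inter> closed_segment A B = {}"
    then obtain W F where WF: "prolongation B C \<inter> closed_segment A D = {W}" "(B - A) \<bullet> (W - A) > 0"
      "F \<in> open_segment B W" "F \<in> closed_segment B C" "orthogonal (A - F) (W - B)"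
      "(B - F) \<bullet> (A - F) \<le> 0" "(C - F) \<bullet> (A - F) \<le> 0" "(D - F) \<bullet> (A - F) \<le> 0"
      using altitude_to_prolonged_side[OF yz C ncol angle_A angle_B] by blast
    have "W \<in> closed_segment A D" using WF(1) by blast
    then show "\<exists>W. prolongation B C \<inter> closed_segment A D = {W} \<and> acute_triangle A B W \<and>
        minimal_perimeter_triangle A B C D (orthic_triangle A B W)"
      using orthic_triangle_minimal[OF ends_in_segment(2) _ WF(3,5,2) _ WF(6-8)] WF(1,4) by blast
  }
  {
    \<comment> \<open>The previous case with \<open>B\<close> and \<open>D\<close> exchanged.\<close>
    assume misses: "perpendicular_at A C \<inter> closed_segment A D = {}"
    have zy: "z > 0" "y > 0" "z + y < 1" and C': "C = A + z *\<^sub>R (D - A) + y *\<^sub>R (B - A)"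
      and ncol': "\<not> collinear {0, D - A, B - A}" and angle_A': "(D - A) \<bullet> (B - A) > 0"
      using yz C ncol angle_A by (simp_all add: insert_commute inner_commute)
    obtain W F where WF: "prolongation D C \<inter> closed_segment A B = {W}" "(D - A) \<bullet> (W - A) > 0"
      "F \<in> open_segment D W" "F \<in> closed_segment D C" "orthogonal (A - F) (W - D)"
      "(D - F) \<bullet> (A - F) \<le> 0" "(C - F) \<bullet> (A - F) \<le> 0" "(B - F) \<bullet> (A - F) \<le> 0"
      using altitude_to_prolonged_side[OF zy C' ncol' angle_A' angle_D misses] .
    have "W \<in> closed_segment A B" using WF(1) by blast
    moreover have "F \<in> open_segment W D" "F \<in> closed_segment C D" "(W - A) \<bullet> (D - A) > 0"
      using WF by (simp_all add: open_segment_commute closed_segment_commute inner_commute)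
    moreover have "orthogonal (A - F) (D - W)"
      using WF(5) by (simp add: orthogonal_def inner_diff_right)
    ultimately show "\<exists>W. prolongation D C \<inter> closed_segment A B = {W} \<and> acute_triangle A W D \<and>
        minimal_perimeter_triangle A B C D (orthic_triangle A W D)"
      using orthic_triangle_minimal[OF _ ends_in_segment(2) _ _ _ _ WF(8,7,6)] WF(1) by blast
  }
qed

end
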